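(* Let $0<\lambda<1$ and let $p(d)\in[0,1]$, $d\in\mathbb{N}$, satisfy $\sum_{d=0}^\infty p(d)\le1$. Put $p(\infty):=1-\sum_{d=0}^\infty p(d)$, $\varphi(x):=\sum_{d=0}^\infty x^dp(d)$ for $x\in[0,1]$, and define $q^*(0):=1$, $q^*(1):=\lambda$ and $q^*(i):=\lambda q^*(i-1)\varphi(q^*(i-1))$ for $i>1$. Suppose that $m:=\min\{d\ge0:p(d)>0\}<\infty$. Then for all $i\ge2$: If $m=0$, $$\lambda\left[\lambda p(0)\right]^{i-1}\le q^*(i)\le\lambda\left[\lambda(1-p(\infty))\right]^{i-1};$$ if $m>0$, $$\lambda^{(m+1)^{i-1}}\left[\lambda p(m)\right]^{\frac{(m+1)^{i-1}-1}{m}}\le q^*(i)\le\lambda^{(m+1)^{i-1}}\left[\lambda(1-p(\infty))\right]^{\frac{(m+1)^{i-1}-1}{m}}.$$ In particular, $q^*$ is bounded between two geometric sequences if $m=0$, and $q^*$ is bounded between two sequences that decay doubly exponentially if $m>0$.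
   Context: $\mathbb{N}$ includes $0$, and $0^0=1$ in the definition of $\varphi$. The numbers $p(d)$ are the limiting outdegree probabilities; their sum may be strictly smaller than one. *)

theory Defs
  imports Complex_Main "HOL-Library.Landau_Symbols"
begin

text \<open>Throughout, \<open>p\<close> is the sequence of limiting outdegree probabilities, which may be
  defective: its total mass may be strictly smaller than one.\<close>

definition p_infty :: "(nat \<Rightarrow> real) \<Rightarrow> real" where
  "p_infty p = 1 - (\<Sum>d. p d)"

definition gen_fun :: "(nat \<Rightarrow> real) \<Rightarrow> real \<Rightarrow> real" where
  "gen_fun p x = (\<Sum>d. x ^ d * p d)"

fun qstar :: "real \<Rightarrow> (nat \<Rightarrow> real) \<Rightarrow> nat \<Rightarrow> real" where
  "qstar lam p 0 = 1"
| "qstar lam p (Suc 0) = lam"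
| "qstar lam p (Suc (Suc i)) =
     lam * qstar lam p (Suc i) * gen_fun p (qstar lam p (Suc i))"

text \<open>The ratio is required to lie strictly between 0 and 1, so that a bound from above by such
  a sequence is not satisfied by a constant and a bound from below is not satisfied by zero.\<close>

definition decaying_geometric :: "(nat \<Rightarrow> real) \<Rightarrow> bool" where
  "decaying_geometric u \<longleftrightarrow> (\<exists>c r. 0 < c \<and> 0 < r \<and> r < 1 \<and> (\<forall>i. u i = c * r ^ i))"

text \<open>That is, \<open>u i = exp (- \<Theta>(b ^ i))\<close> for some base \<open>b > 1\<close>; the order of decay is fixed on both
  sides, so a sequence decaying even faster (or equal to zero) does not qualify.\<close>

definition doubly_exponential_decay :: "(nat \<Rightarrow> real) \<Rightarrow> bool" where
  "doubly_exponential_decay u \<longleftrightarrow>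
     (\<forall>i. 0 < u i) \<and> (\<exists>b>1. (\<lambda>i. - ln (u i)) \<in> \<Theta>(\<lambda>i. b ^ i))"

end

theory Submission
  imports Defs "HOL-Real_Asymp.Real_Asymp"
begin

text \<open>
  For \<open>x \<in> [0, 1]\<close> every power \<open>x ^ d\<close> in \<open>\<phi> x = (\<Sum>d. x ^ d * p d)\<close> with \<open>p d > 0\<close> is at most
  \<open>x ^ m\<close>, and the term \<open>d = m\<close> alone contributes \<open>x ^ m * p m\<close>; hence
  \<open>x ^ m * p m \<le> \<phi> x \<le> x ^ m * (\<Sum>d. p d)\<close> (lemma \<open>gen_fun_bounds\<close>).  So \<open>q\<^sup>*\<close> is squeezed between
  two sequences obeying a pure monomial recursion \<open>a (Suc n) = c * a n ^ (m + 1)\<close>, with \<open>c\<close> equal to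
  \<open>\<lambda> p m\<close> and to \<open>\<lambda> (1 - p \<infinity>)\<close>.  That recursion has the solution
  \<open>a 0 ^ ((m + 1) ^ n) * c ^ (\<Sum>k<n. (m + 1) ^ k)\<close>, and the monomial is monotone, so the comparison
  propagates along the recursion (lemmas \<open>monomial_recursion_lower\<close> and
  \<open>monomial_recursion_upper\<close>).

  This form is uniform in \<open>m\<close>.  The dichotomy of the theorem only enters when the exponent
  \<open>\<Sum>k<n. (m + 1) ^ k\<close> is evaluated: it is \<open>n\<close> for \<open>m = 0\<close> and \<open>((m + 1) ^ n - 1) / m\<close> for
  \<open>m > 0\<close>.  In the first case the bounds are geometric as they stand; in the second both exponents
  are of order \<open>(m + 1) ^ n\<close>, which is doubly exponential decay.
\<close>

section \<open>The generating function near its lowest-order term\<close>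

text \<open>The interval \<open>[0, 1]\<close> serves twice: there the power series is dominated by \<open>\<Sum>d. p d\<close>, and
  \<open>x ^ d\<close> decreases in \<open>d\<close>, so the lowest power that occurs controls all the others.\<close>

lemma gen_fun_bounds:
  assumes "\<And>d. 0 \<le> p d" "summable p" "\<And>d. d < m \<Longrightarrow> p d = 0" "0 \<le> x" "x \<le> 1"
  shows "x ^ m * p m \<le> gen_fun p x" and "gen_fun p x \<le> x ^ m * (\<Sum>d. p d)"
proof -
  have "x ^ d * p d \<le> p d" for d
    using assms by (simp add: mult_left_le_one_le power_le_one)
  then have summ: "summable (\<lambda>d. x ^ d * p d)"
    using assms by (intro summable_comparison_test'[OF \<open>summable p\<close>]) simp
  show "x ^ m * p m \<le> gen_fun p x"
    using sum_le_suminf[OF summ, of "{m}"] assms by (simp add: gen_fun_def)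
  have le: "x ^ d * p d \<le> x ^ m * p d" for d
  proof (cases "d < m")
    case False
    then show ?thesis
      using assms by (intro mult_right_mono power_decreasing) auto
  qed (use assms in simp)
  have "gen_fun p x \<le> (\<Sum>d. x ^ m * p d)"
    unfolding gen_fun_def by (intro suminf_le le summ summable_mult assms)
  then show "gen_fun p x \<le> x ^ m * (\<Sum>d. p d)"
    by (simp add: suminf_mult assms)
qed

section \<open>Comparison with monomial recursions\<close>

text \<open>One step of the recursion on its closed form: both exponents are multiplied by \<open>m + 1\<close>, and the
  new factor \<open>c\<close> supplies the term \<open>k = 0\<close> missing from the shifted geometric sum.\<close>

lemma monomial_recursion_closed_form:
  fixes x c :: real
  shows "c * (x ^ (Suc m ^ n) * c ^ (\<Sum>k<n. Suc m ^ k)) ^ Suc m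
    = x ^ (Suc m ^ Suc n) * c ^ (\<Sum>k<Suc n. Suc m ^ k)"
proof -
  have "(\<Sum>k<Suc n. Suc m ^ k) = Suc ((\<Sum>k<n. Suc m ^ k) * Suc m)"
    by (simp only: sum.lessThan_Suc_shift) (simp add: sum_distrib_left algebra_simps)
  then show ?thesis
    by (simp only: power_mult_distrib power_mult[symmetric] power_Suc2[of c] power_Suc2[of "Suc m"]
        mult_ac)
qed

lemma monomial_recursion_lower:
  fixes a :: "nat \<Rightarrow> real"
  assumes "0 \<le> c" "0 \<le> a 0" and step: "\<And>n. c * a n ^ Suc m \<le> a (Suc n)"
  shows "a 0 ^ (Suc m ^ n) * c ^ (\<Sum>k<n. Suc m ^ k) \<le> a n"
proof (induction n)
  case (Suc n)
  have "c * (a 0 ^ (Suc m ^ n) * c ^ (\<Sum>k<n. Suc m ^ k)) ^ Suc m \<le> c * a n ^ Suc m"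
    using assms Suc by (intro mult_left_mono power_mono) auto
  then show ?case
    unfolding monomial_recursion_closed_form using step[of n] by linarith
qed simp

lemma monomial_recursion_upper:
  fixes a :: "nat \<Rightarrow> real"
  assumes "0 \<le> c" "\<And>n. 0 \<le> a n" and step: "\<And>n. a (Suc n) \<le> c * a n ^ Suc m"
  shows "a n \<le> a 0 ^ (Suc m ^ n) * c ^ (\<Sum>k<n. Suc m ^ k)"
proof (induction n)
  case (Suc n)
  have "c * a n ^ Suc m \<le> c * (a 0 ^ (Suc m ^ n) * c ^ (\<Sum>k<n. Suc m ^ k)) ^ Suc m"
    using assms Suc by (intro mult_left_mono power_mono) auto
  then show ?case
    unfolding monomial_recursion_closed_form using step[of n] by linarith
qed simp

section \<open>Uniform bounds for \<open>q\<^sup>*\<close>\<close>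

text \<open>The bounds on \<open>\<phi>\<close> hold on \<open>[0, 1]\<close>, so the sequence has to be kept there; the case
  \<open>m = 0\<close> of those bounds gives \<open>0 \<le> \<phi> \<le> 1\<close>, which is enough.\<close>

lemma qstar_mem:
  assumes "0 \<le> lam" "lam \<le> 1" "\<And>d. 0 \<le> p d" "summable p" "(\<Sum>d. p d) \<le> 1"
  shows "0 \<le> qstar lam p i" "qstar lam p i \<le> 1"
proof -
  have phi: "0 \<le> gen_fun p x" "gen_fun p x \<le> 1" if "0 \<le> x" "x \<le> 1" for x
    using gen_fun_bounds[of p 0 x] that assms(3-5) by (auto intro: order_trans)
  have "0 \<le> qstar lam p (Suc n) \<and> qstar lam p (Suc n) \<le> 1" for n
    by (induction n) (use assms(1,2) phi in \<open>auto intro!: mult_le_one mult_nonneg_nonneg\<close>)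
  then show "0 \<le> qstar lam p i" "qstar lam p i \<le> 1"
    by (cases i; simp)+
qed

text \<open>The monomial recursion starts at \<open>q\<^sup>* 1 = \<lambda>\<close> rather than at \<open>q\<^sup>* 0 = 1\<close>: the step from index \<open>0\<close>
  to index \<open>1\<close> is not governed by the recursion.  This is the origin of the shift \<open>i - 1\<close>.\<close>

lemma qstar_bounds:
  assumes "0 \<le> lam" "lam \<le> 1" "\<And>d. 0 \<le> p d" "summable p" "(\<Sum>d. p d) \<le> 1"
    and "\<And>d. d < m \<Longrightarrow> p d = 0"
  shows "lam ^ (Suc m ^ n) * (lam * p m) ^ (\<Sum>k<n. Suc m ^ k) \<le> qstar lam p (Suc n)"
    and "qstar lam p (Suc n) \<le> lam ^ (Suc m ^ n) * (lam * (\<Sum>d. p d)) ^ (\<Sum>k<n. Suc m ^ k)"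
proof -
  define a where "a n = qstar lam p (Suc n)" for n
  have a01: "0 \<le> a n" "a n \<le> 1" for n
    using qstar_mem[of lam p "Suc n"] assms(1-5) by (auto simp: a_def)
  have rec: "a (Suc n) = lam * a n * gen_fun p (a n)" for n
    by (simp add: a_def)
  note phi = gen_fun_bounds[OF assms(3,4,6) a01]
  have lower: "lam * p m * a n ^ Suc m \<le> a (Suc n)" for n
    using mult_left_mono[OF phi(1)[of m n], of "lam * a n"] a01[of n] assms(1)
    by (simp add: rec mult_ac)
  have upper: "a (Suc n) \<le> lam * (\<Sum>d. p d) * a n ^ Suc m" for n
    using mult_left_mono[OF phi(2)[of m n], of "lam * a n"] a01[of n] assms(1)
    by (simp add: rec mult_ac)
  have "a 0 ^ (Suc m ^ n) * (lam * p m) ^ (\<Sum>k<n. Suc m ^ k) \<le> a n"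
    by (intro monomial_recursion_lower lower a01) (use assms in simp)
  then show "lam ^ (Suc m ^ n) * (lam * p m) ^ (\<Sum>k<n. Suc m ^ k) \<le> qstar lam p (Suc n)"
    by (simp add: a_def)
  have "a n \<le> a 0 ^ (Suc m ^ n) * (lam * (\<Sum>d. p d)) ^ (\<Sum>k<n. Suc m ^ k)"
    by (intro monomial_recursion_upper upper a01) (use assms in \<open>simp add: suminf_nonneg\<close>)
  then show "qstar lam p (Suc n) \<le> lam ^ (Suc m ^ n) * (lam * (\<Sum>d. p d)) ^ (\<Sum>k<n. Suc m ^ k)"
    by (simp add: a_def)
qed

section \<open>Rates of decay\<close>

lemma geometric_exponent:
  assumes "0 < m"
  shows "real (\<Sum>k<n. Suc m ^ k) = ((real m + 1) ^ n - 1) / real m"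
  using geometric_sum[of "real m + 1" n] assms by (simp add: add.commute)

text \<open>Taking \<open>- ln\<close> turns the constant factor into a bounded term, which is negligible
  against \<open>b ^ i\<close>; this leaves the freedom to adjust a bound at index \<open>0\<close>.\<close>

lemma doubly_exponential_decay_powr:
  fixes a b c :: real
  assumes "0 < c" "0 < a" "a < 1" "1 < b"
  shows "doubly_exponential_decay (\<lambda>i. c * a powr (b ^ i))"
proof -
  define s where "s = - ln a"
  have "s > 0"
    using assms by (simp add: s_def)
  have "(\<lambda>i. s * b ^ i - ln c) \<in> \<Theta>(\<lambda>i. b ^ i)"
    using \<open>s > 0\<close> \<open>1 < b\<close> by real_asymp
  moreover have "- ln (c * a powr (b ^ i)) = s * b ^ i - ln c" for i
    using assms by (simp add: ln_mult ln_powr s_def)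
  ultimately show ?thesis
    using assms by (auto simp: doubly_exponential_decay_def)
qed

section \<open>Geometric and doubly exponential bounds\<close>

theorem proposition6:
  fixes lam :: real and p :: "nat \<Rightarrow> real" and m :: nat
  assumes "0 < lam" and "lam < 1"
    and "\<And>d. 0 \<le> p d" and "\<And>d. p d \<le> 1"
    and "summable p" and "(\<Sum>d. p d) \<le> 1"
    and "\<exists>d. 0 < p d" and "m = (LEAST d. 0 < p d)"
  shows
    "(\<forall>i\<ge>2.
        (m = 0 \<longrightarrow>
           lam * (lam * p 0) ^ (i - 1) \<le> qstar lam p i \<and>
           qstar lam p i \<le> lam * (lam * (1 - p_infty p)) ^ (i - 1)) \<and>
        (m > 0 \<longrightarrow>
           lam ^ ((m + 1) ^ (i - 1))
             * (lam * p m) powr (((real m + 1) ^ (i - 1) - 1) / real m) \<le> qstar lam p i \<and>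
           qstar lam p i \<le> lam ^ ((m + 1) ^ (i - 1))
             * (lam * (1 - p_infty p)) powr (((real m + 1) ^ (i - 1) - 1) / real m))) \<and>
     (m = 0 \<longrightarrow>
        (\<exists>u v. decaying_geometric u \<and> decaying_geometric v \<and>
           (\<forall>i. u i \<le> qstar lam p i \<and> qstar lam p i \<le> v i))) \<and>
     (m > 0 \<longrightarrow>
        (\<exists>u v. doubly_exponential_decay u \<and> doubly_exponential_decay v \<and>
           (\<forall>i. u i \<le> qstar lam p i \<and> qstar lam p i \<le> v i)))"
proof -
  define S where "S = (\<Sum>d. p d)"
  have S_eq: "1 - p_infty p = S"
    by (simp add: p_infty_def S_def)
  have pm: "0 < p m"
    unfolding assms(8) using assms(7) by (rule LeastI_ex)
  have below: "p d = 0" if "d < m" for d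
    using not_less_Least[of d "\<lambda>d. 0 < p d"] that assms(3)[of d] assms(8) by force
  have "p m \<le> S"
    using sum_le_suminf[OF assms(5), of "{m}"] assms(3) by (simp add: S_def)
  with pm have S: "0 < S" "S \<le> 1"
    using assms(6) by (auto simp: S_def)
  have lp: "0 < lam * p m" "lam * p m < 1"
    using assms(1,2) pm assms(4)[of m] by (auto intro: le_less_trans[OF mult_left_le])
  have lS: "0 < lam * S" "lam * S < 1"
    using assms(1,2) S by (auto intro: le_less_trans[OF mult_left_le])
  have lower: "lam ^ (Suc m ^ n) * (lam * p m) ^ (\<Sum>k<n. Suc m ^ k) \<le> qstar lam p (Suc n)"
    and upper: "qstar lam p (Suc n) \<le> lam ^ (Suc m ^ n) * (lam * S) ^ (\<Sum>k<n. Suc m ^ k)" for n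
    using qstar_bounds[of lam p m n] assms(1-6) below by (auto simp: S_def)

  have explicit:
    "(m = 0 \<longrightarrow>
         lam * (lam * p 0) ^ (i - 1) \<le> qstar lam p i \<and>
         qstar lam p i \<le> lam * (lam * (1 - p_infty p)) ^ (i - 1)) \<and>
     (m > 0 \<longrightarrow>
         lam ^ ((m + 1) ^ (i - 1))
           * (lam * p m) powr (((real m + 1) ^ (i - 1) - 1) / real m) \<le> qstar lam p i \<and>
         qstar lam p i \<le> lam ^ ((m + 1) ^ (i - 1))
           * (lam * (1 - p_infty p)) powr (((real m + 1) ^ (i - 1) - 1) / real m))"
    if pos: "1 \<le> i" for i
  proof -
    obtain n where i: "i = Suc n"
      using pos by (cases i) auto
    show ?thesis
    proof (cases "m = 0")
      case True
      then show ?thesis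
        using lower[of n] upper[of n] by (simp add: i S_eq)
    next
      case False
      then have "c powr (((real m + 1) ^ n - 1) / real m) = c ^ (\<Sum>k<n. Suc m ^ k)" if "0 < c" for c
        using geometric_exponent[of m n] that by (metis neq0_conv powr_realpow)
      then show ?thesis
        using False lower[of n] upper[of n] lp(1) lS(1) by (simp add: i S_eq)
    qed
  qed

  have geometric: "\<exists>u v. decaying_geometric u \<and> decaying_geometric v \<and>
      (\<forall>i. u i \<le> qstar lam p i \<and> qstar lam p i \<le> v i)" if "m = 0"
  proof -
    \<comment> \<open>Since \<open>q\<^sup>* 0 = 1\<close>, the explicit bounds need not extend to index \<open>0\<close>.  The lower one is
      therefore shifted by one index; the upper one is \<open>1 / S \<ge> 1\<close> there.\<close>
    define u v where "u i = lam * (lam * p 0) ^ i" and "v i = 1 / S * (lam * S) ^ i" for i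
    have "decaying_geometric u"
      unfolding decaying_geometric_def u_def using lp assms(1) that
      by (intro exI[of _ lam] exI[of _ "lam * p 0"]) auto
    moreover have "decaying_geometric v"
      unfolding decaying_geometric_def v_def using lS S
      by (intro exI[of _ "1 / S"] exI[of _ "lam * S"]) auto
    moreover have "u i \<le> qstar lam p i \<and> qstar lam p i \<le> v i" for i
    proof (cases i)
      case 0
      then show ?thesis
        using assms(2) S by (simp add: u_def v_def)
    next
      case (Suc n)
      have "u i \<le> lam * (lam * p 0) ^ n"
        unfolding u_def using lp assms(1) that Suc
        by (intro mult_left_mono power_decreasing) auto
      moreover have "v i = lam * (lam * S) ^ n"
        using S by (simp add: v_def Suc)
      ultimately show ?thesis
        using explicit[of i] that by (simp add: Suc S_eq)
    qed
    ultimately show ?thesis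
      by blast
  qed

  have doubly: "\<exists>u v. doubly_exponential_decay u \<and> doubly_exponential_decay v \<and>
      (\<forall>i. u i \<le> qstar lam p i \<and> qstar lam p i \<le> v i)" if "m > 0"
  proof -
    define b where "b = real (Suc m)"
    have b: "b > 1"
      using that by (simp add: b_def)
    \<comment> \<open>Both exponents in the lower bound at index \<open>Suc n\<close> are at most \<open>b ^ Suc n\<close>.  For the upper
      bound the power of \<open>\<lambda> S < 1\<close> is dropped and \<open>b ^ n\<close> written as \<open>b ^ Suc n / b\<close>; the factor
      \<open>1 / \<lambda>\<close> is there for index \<open>0\<close>, where \<open>q\<^sup>*\<close> is \<open>1\<close>.
      The factor \<open>1\<close> in \<open>u\<close> only makes it an instance of \<open>doubly_exponential_decay_powr\<close>.\<close>
    define u v where "u i = 1 * (lam * (lam * p m)) powr (b ^ i)"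
      and "v i = 1 / lam * (lam powr (1 / b)) powr (b ^ i)" for i
    have A: "0 < lam * (lam * p m)" "lam * (lam * p m) < 1"
      using lp assms(1,2) by (auto intro: le_less_trans[OF mult_left_le])
    have "doubly_exponential_decay u"
      unfolding u_def using A b by (intro doubly_exponential_decay_powr) auto
    moreover have "doubly_exponential_decay v"
      unfolding v_def using assms(1,2) b powr_less_mono2[of "1 / b" lam 1]
      by (intro doubly_exponential_decay_powr) auto
    moreover have "u i \<le> qstar lam p i \<and> qstar lam p i \<le> v i" for i
    proof (cases i)
      case 0
      have "lam powr 1 \<le> lam powr (1 / b)"
        using assms(1,2) b by (intro powr_mono') auto
      with 0 show ?thesis
        using assms(1,2) A by (simp add: u_def v_def)
    next
      case (Suc n)
      have u_eq: "u i = lam ^ (Suc m ^ i) * (lam * p m) ^ (Suc m ^ i)"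
        using A powr_realpow[of "lam * (lam * p m)" "Suc m ^ i"]
        by (simp add: u_def b_def power_mult_distrib)
      have "(\<Sum>k<n. Suc m ^ k) \<le> Suc m ^ n"
        using that
      proof (induction n)
        case (Suc n)
        have "1 * Suc m ^ n \<le> m * Suc m ^ n"
          using Suc.prems by (intro mult_right_mono) auto
        moreover have "(\<Sum>k<n. Suc m ^ k) \<le> Suc m ^ n"
          using Suc by blast
        ultimately have "(\<Sum>k<n. Suc m ^ k) \<le> m * Suc m ^ n"
          by linarith
        then show ?case
          by simp
      qed simp
      moreover have e1: "Suc m ^ n \<le> Suc m ^ i"
        unfolding Suc by (intro power_increasing) auto
      ultimately have e2: "(\<Sum>k<n. Suc m ^ k) \<le> Suc m ^ i"
        by (rule order_trans)
      have "lam ^ (Suc m ^ i) \<le> lam ^ (Suc m ^ n)"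
        using assms(1,2) by (intro power_decreasing e1) auto
      moreover have "(lam * p m) ^ (Suc m ^ i) \<le> (lam * p m) ^ (\<Sum>k<n. Suc m ^ k)"
        using lp by (intro power_decreasing e2) auto
      ultimately have "u i \<le> lam ^ (Suc m ^ n) * (lam * p m) ^ (\<Sum>k<n. Suc m ^ k)"
        unfolding u_eq using assms(1) lp by (intro mult_mono zero_le_power) auto
      moreover have "lam ^ (Suc m ^ n) * (lam * S) ^ (\<Sum>k<n. Suc m ^ k) \<le> v i"
      proof -
        have "v i = 1 / lam * lam ^ (Suc m ^ n)"
          using assms(1) powr_realpow[of lam "Suc m ^ n"]
          by (simp add: v_def Suc powr_powr b_def)
        also have "\<dots> \<ge> 1 * lam ^ (Suc m ^ n)"
          using assms(1,2) by (intro mult_right_mono) auto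
        finally have "lam ^ (Suc m ^ n) \<le> v i"
          by simp
        moreover have "lam ^ (Suc m ^ n) * (lam * S) ^ (\<Sum>k<n. Suc m ^ k) \<le> lam ^ (Suc m ^ n)"
          using lS assms(1) by (intro mult_left_le power_le_one) auto
        ultimately show ?thesis
          by linarith
      qed
      ultimately show ?thesis
        using lower[of n] upper[of n] unfolding Suc by linarith
    qed
    ultimately show ?thesis
      by blast
  qed

  show ?thesis
    by (intro conjI allI impI) (use explicit geometric doubly in auto)
qed

end
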